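(* Let $q$ be a prime power, let $n>k\ge 2$ be integers, let $G\in\mathbb{F}_q^{k\times n}$ be a matrix of rank $k$ with no zero column, and let $\mathcal{R}=(\mathcal{R}_1,\ldots,\mathcal{R}_k)$ be a $G$-system. Then the following hold. 1. The vertices of $\Lambda(\mathcal{R})$ have rational entries. 2. $\Lambda(\mathcal{R})\cap\mathbb{Q}^k=f(\mathcal{A}(\mathcal{R})\cap\mathbb{Q}^{m})$, where $m=m(\mathcal{R})=|\mathcal{R}_1|+\cdots+|\mathcal{R}_k|$ and $f:\mathbb{R}^{m}\to\mathbb{R}^k$ is the linear map $$f:\ (\lambda_{i,R}\mid i\in\{1,\ldots,k\},\,R\in\mathcal{R}_i)\mapsto\left(\sum_{R\in\mathcal{R}_1}\lambda_{1,R},\ldots,\sum_{R\in\mathcal{R}_k}\lambda_{k,R}\right).$$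
   Context: Let $G^\nu$ denote the $\nu$-th column of $G$ and $e_i$ the $i$-th standard basis vector of $\mathbb{F}_q^k$. For $i\in\{1,\ldots,k\}$ let $\mathcal{R}_i^{\mathrm{all}}(G)=\{R\subseteq\{1,\ldots,n\}\mid e_i\in\langle G^\nu\mid\nu\in R\rangle\}$, where $\langle\cdot\rangle$ is the $\mathbb{F}_q$-span. A $G$-system is a $k$-tuple $\mathcal{R}=(\mathcal{R}_1,\ldots,\mathcal{R}_k)$ with $\emptyset\ne\mathcal{R}_i\subseteq\mathcal{R}_i^{\mathrm{all}}(G)$ for all $i$. The allocation polytope $\mathcal{A}(\mathcal{R})\subseteq\mathbb{R}^{m(\mathcal{R})}$ is the set of all real tuples $(\lambda_{i,R}\mid i\in\{1,\ldots,k\},R\in\mathcal{R}_i)$ such that $\lambda_{i,R}\ge 0$ for all $i,R$ and $\sum_{i=1}^k\sum_{R\in\mathcal{R}_i,\,\nu\in R}\lambda_{i,R}\le 1$ for all $\nu\in\{1,\ldots,n\}$. The service rate region $\Lambda(\mathcal{R})\subseteq\mathbb{R}^k$ (with server capacity $1$) is the set of all $(\lambda_1,\ldots,\lambda_k)\in\mathbb{R}^k$ for which there exists $(\lambda_{i,R})\in\mathcal{A}(\mathcal{R})$ with $\sum_{R\in\mathcal{R}_i}\lambda_{i,R}=\lambda_i$ for all $i\in\{1,\ldots,k\}$. It is a polytope. A vertex of a polytope $\mathcal{P}$ is a point $v\in\mathcal{P}$ not lying in the convex hull of $\mathcal{P}\setminus\{v\}$. *)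

theory Defs
  imports "HOL-Analysis.Analysis"
begin

text \<open>
  The index sets of size \<open>k\<close> and \<open>n\<close> are finite types \<open>'k\<close> and \<open>'n\<close>, and the field with
  \<open>q\<close> elements is a type \<open>'a::{field,finite}\<close>, so that \<open>q = CARD('a)\<close> is automatically a
  prime power.
\<close>

definition recovery_all :: "'a::{field,finite} ^ 'n::finite ^ 'k::finite \<Rightarrow> 'k \<Rightarrow> 'n set set" where
  "recovery_all G i = {R. axis i 1 \<in> vec.span ((\<lambda>\<nu>. column \<nu> G) ` R)}"

definition G_system :: "'a::{field,finite} ^ 'n::finite ^ 'k::finite \<Rightarrow> ('k \<Rightarrow> 'n set set) \<Rightarrow> bool" where
  "G_system G \<R> \<longleftrightarrow> (\<forall>i. \<R> i \<noteq> {} \<and> \<R> i \<subseteq> recovery_all G i)"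

text \<open>
  The space of real tuples indexed by the pairs \<open>(i, R)\<close> with \<open>R \<in> \<R> i\<close>. There are
  \<open>m = (\<Sum>i\<in>UNIV. card (\<R> i))\<close> such pairs, so this is \<open>m\<close>-dimensional real space.
  Tuples are extensional functions (\<open>undefined\<close> off the index set), so that equality of
  functions is equality of tuples.
\<close>

definition tuple_index :: "('k::finite \<Rightarrow> 'n::finite set set) \<Rightarrow> ('k \<times> 'n set) set" where
  "tuple_index \<R> = (SIGMA i:UNIV. \<R> i)"

definition real_tuples :: "('k::finite \<Rightarrow> 'n::finite set set) \<Rightarrow> ('k \<times> 'n set \<Rightarrow> real) set" where
  "real_tuples \<R> = (\<Pi>\<^sub>E p\<in>tuple_index \<R>. UNIV)"

definition rational_tuples :: "('k::finite \<Rightarrow> 'n::finite set set) \<Rightarrow> ('k \<times> 'n set \<Rightarrow> real) set" where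
  "rational_tuples \<R> = (\<Pi>\<^sub>E p\<in>tuple_index \<R>. \<rat>)"

definition rational_vectors :: "(real ^ 'k::finite) set" where
  "rational_vectors = {x. \<forall>i. x $ i \<in> \<rat>}"

definition allocation_polytope :: "('k::finite \<Rightarrow> 'n::finite set set) \<Rightarrow> ('k \<times> 'n set \<Rightarrow> real) set" where
  "allocation_polytope \<R> = {l \<in> real_tuples \<R>.
     (\<forall>i. \<forall>R\<in>\<R> i. 0 \<le> l (i, R)) \<and>
     (\<forall>\<nu>. (\<Sum>i\<in>UNIV. \<Sum>R\<in>{R \<in> \<R> i. \<nu> \<in> R}. l (i, R)) \<le> 1)}"

definition rate_map :: "('k::finite \<Rightarrow> 'n::finite set set) \<Rightarrow> ('k \<times> 'n set \<Rightarrow> real) \<Rightarrow> real ^ 'k" where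
  "rate_map \<R> l = (\<chi> i. \<Sum>R\<in>\<R> i. l (i, R))"

definition service_rate_region :: "('k::finite \<Rightarrow> 'n::finite set set) \<Rightarrow> (real ^ 'k) set" where
  "service_rate_region \<R> =
     {x. \<exists>l\<in>allocation_polytope \<R>. \<forall>i. (\<Sum>R\<in>\<R> i. l (i, R)) = x $ i}"

definition vertex_of :: "'v::real_vector \<Rightarrow> 'v set \<Rightarrow> bool" where
  "vertex_of v P \<longleftrightarrow> v \<in> P \<and> v \<notin> convex hull (P - {v})"

end

theory Submission
  imports Defs
begin

text \<open>
  Both parts come from one observation: allocations are cut out by linear conditions with rational
  coefficients, and such conditions cannot tell a real number from its image under a suitable
  \<open>\<rat>\<close>-linear map \<open>\<phi> : \<real> \<rightarrow> \<rat>\<close> with \<open>\<phi> 1 = 1\<close>. Applied to every entry of a tuple, such a map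
  preserves all equations with rational coefficients, so only the inequalities can break, namely
  the nonnegativity of the entries and of the slacks \<open>1 - (load of \<nu>)\<close>. These are
  finitely many numbers, and \<open>\<phi>\<close> can be chosen so close to the identity on them that their signs
  survive: take a basis of \<open>\<real>\<close> over \<open>\<rat>\<close> that contains \<open>1\<close> and move each other basis element to
  a nearby rational number (lemma \<open>rational_additive_approximation\<close>).

  An allocation \<open>l\<close> with rational rates is thus turned into the rational allocation \<open>\<phi> \<circ> l\<close> with
  the same rates, because \<open>\<phi>\<close> fixes \<open>\<rat>\<close>; this is the second part. For the first part, the
  reflected map \<open>x \<mapsto> 2 * x - \<phi> x\<close> is as close to the identity as \<open>\<phi>\<close> is, so for a point \<open>v\<close> of
  the region both \<open>\<phi> v\<close> and \<open>2 v - \<phi> v\<close> lie in the region. Their midpoint is \<open>v\<close>; if \<open>v\<close> is a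
  vertex, this forces \<open>\<phi> v = v\<close>, so \<open>v\<close> is rational.
\<close>

section \<open>Additive maps from the reals to the rationals close to the identity\<close>

interpretation rat_real: vector_space "\<lambda>(q::rat) (x::real). of_rat q * x"
  by unfold_locales (simp_all add: algebra_simps of_rat_add of_rat_mult)

interpretation rat_real_pair: vector_space_pair
  "\<lambda>(q::rat) (x::real). of_rat q * x" "\<lambda>(q::rat) (x::real). of_rat q * x" ..

text \<open>
  The bound is relative, \<open>\<bar>x\<bar>\<close> instead of a fixed \<open>\<epsilon>\<close>, so that both \<open>\<phi> x\<close> and \<open>2 * x - \<phi> x\<close>
  are nonnegative whenever \<open>x \<in> S\<close> is. It is attainable because each \<open>x\<close> is a rational
  combination of finitely many basis elements: the error at \<open>x\<close> is at most a constant depending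
  on \<open>x\<close> times the error \<open>\<delta>\<close> allowed on the basis, and it vanishes at \<open>x = 0\<close>.
\<close>

lemma rational_additive_approximation:
  fixes S :: "real set"
  assumes "finite S"
  obtains \<phi> :: "real \<Rightarrow> real"
  where "Modules.additive \<phi>" "\<And>x. \<phi> x \<in> \<rat>" "\<And>q. q \<in> \<rat> \<Longrightarrow> \<phi> q = q"
    "\<And>x. x \<in> S \<Longrightarrow> \<bar>\<phi> x - x\<bar> \<le> \<bar>x\<bar>"
proof -
  have ind1: "rat_real.independent {1}"
    by simp
  define B where "B = rat_real.extend_basis {1}"
  have indB: "rat_real.independent B" and spanB: "rat_real.span B = UNIV" and "1 \<in> B"
    using rat_real.independent_extend_basis[OF ind1] rat_real.span_extend_basis[OF ind1]
      rat_real.extend_basis_superset[OF ind1] by (auto simp: B_def)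
  have "\<exists>t r. finite t \<and> t \<subseteq> B \<and> x = (\<Sum>a\<in>t. of_rat (r a) * a)" for x
    using spanB unfolding rat_real.span_explicit by blast
  then obtain t r where fin: "finite (t x)" and sub: "t x \<subseteq> B"
    and x_eq: "x = (\<Sum>a\<in>t x. of_rat (r x a) * a)" for x
    by metis
  define c where "c x = (\<Sum>a\<in>t x. \<bar>of_rat (r x a)\<bar> :: real)" for x
  have "\<forall>\<^sub>F \<delta> in at_right 0. x \<noteq> 0 \<longrightarrow> c x * \<delta> < \<bar>x\<bar>" for x
  proof (cases "x = 0")
    case False
    have "((\<lambda>\<delta>. c x * \<delta>) \<longlongrightarrow> c x * 0) (at_right 0)"
      by (intro tendsto_intros)
    then show ?thesis
      using False by (auto dest!: order_tendstoD(2)[where a = "\<bar>x\<bar>"] elim: eventually_mono)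
  qed simp
  then have "\<forall>\<^sub>F \<delta> in at_right 0. \<forall>x\<in>S. x \<noteq> 0 \<longrightarrow> c x * \<delta> < \<bar>x\<bar>"
    using assms by (simp add: eventually_ball_finite)
  then have "\<forall>\<^sub>F \<delta> in at_right (0::real). \<delta> > 0 \<and> (\<forall>x\<in>S. x \<noteq> 0 \<longrightarrow> c x * \<delta> < \<bar>x\<bar>)"
    by (intro eventually_conj eventually_at_right_less)
  then obtain \<delta> :: real where "\<delta> > 0" and \<delta>: "\<And>x. x \<in> S \<Longrightarrow> x \<noteq> 0 \<Longrightarrow> c x * \<delta> < \<bar>x\<bar>"
    using eventually_happens'[OF trivial_limit_at_right_real] by blast
  have "\<exists>q\<in>\<rat>. \<bar>q - b\<bar> \<le> \<delta> \<and> (b = 1 \<longrightarrow> q = 1)" for b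
  proof (cases "b = 1")
    case False
    obtain q where "q \<in> \<rat>" "b < q" "q < b + \<delta>"
      using Rats_dense_in_real[of b "b + \<delta>"] \<open>\<delta> > 0\<close> by auto
    with False show ?thesis
      by (intro bexI[of _ q]) auto
  qed (use \<open>\<delta> > 0\<close> in auto)
  then obtain g where g_rat: "g b \<in> \<rat>" and g_near: "\<bar>g b - b\<bar> \<le> \<delta>" and g_1: "b = 1 \<Longrightarrow> g b = 1" for b
    by metis
  obtain \<phi> where lin: "Vector_Spaces.linear (\<lambda>q x. of_rat q * x) (\<lambda>q x. of_rat q * x) \<phi>"
    and \<phi>_B: "\<And>b. b \<in> B \<Longrightarrow> \<phi> b = g b"
    using rat_real_pair.linear_independent_extend[OF indB, of g] by blast
  have scale: "\<phi> (of_rat q * x) = of_rat q * \<phi> x" for q x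
    using rat_real_pair.linear_scale[OF lin] .
  have \<phi>_eq: "\<phi> x = (\<Sum>a\<in>t x. of_rat (r x a) * g a)" for x
  proof -
    have "\<phi> x = \<phi> (\<Sum>a\<in>t x. of_rat (r x a) * a)"
      using x_eq by simp
    also have "\<dots> = (\<Sum>a\<in>t x. \<phi> (of_rat (r x a) * a))"
      by (rule rat_real_pair.linear_sum[OF lin])
    also have "\<dots> = (\<Sum>a\<in>t x. of_rat (r x a) * g a)"
      using sub[of x] by (intro sum.cong) (auto simp: scale \<phi>_B)
    finally show ?thesis .
  qed
  show thesis
  proof
    show "Modules.additive \<phi>"
      by unfold_locales (rule rat_real_pair.linear_add[OF lin])
    show "\<phi> x \<in> \<rat>" for x
      unfolding \<phi>_eq by (intro Rats_sum Rats_mult g_rat Rats_of_rat)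
    show "\<phi> q = q" if "q \<in> \<rat>" for q
      using that scale[of _ 1] \<phi>_B[OF \<open>1 \<in> B\<close>] g_1[of 1] by (auto elim: Rats_cases)
    show "\<bar>\<phi> x - x\<bar> \<le> \<bar>x\<bar>" if "x \<in> S" for x
    proof (cases "x = 0")
      case True
      then show ?thesis
        using rat_real_pair.linear_0[OF lin] by simp
    next
      case False
      have "\<phi> x - x = (\<Sum>a\<in>t x. of_rat (r x a) * (g a - a))"
        by (subst (2) x_eq) (simp add: \<phi>_eq sum_subtractf algebra_simps)
      also have "\<bar>\<dots>\<bar> \<le> (\<Sum>a\<in>t x. \<bar>of_rat (r x a) * (g a - a)\<bar>)"
        by (rule sum_abs)
      also have "\<dots> \<le> c x * \<delta>"
        unfolding c_def sum_distrib_right abs_mult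
        by (intro sum_mono mult_left_mono g_near) auto
      also have "\<dots> \<le> \<bar>x\<bar>"
        using \<delta>[OF that False] by simp
      finally show ?thesis .
    qed
  qed
qed

section \<open>Transporting allocations along additive maps\<close>

lemma allocation_polytope_eq:
  "allocation_polytope \<R> = {l \<in> real_tuples \<R>. (\<forall>p\<in>tuple_index \<R>. 0 \<le> l p) \<and>
     (\<forall>\<nu>. 0 \<le> 1 - (\<Sum>i\<in>UNIV. \<Sum>R\<in>{R \<in> \<R> i. \<nu> \<in> R}. l (i, R)))}"
  by (auto simp: allocation_polytope_def tuple_index_def)

lemma service_rate_region_eq_image:
  "service_rate_region \<R> = rate_map \<R> ` allocation_polytope \<R>"
  by (auto simp: service_rate_region_def rate_map_def vec_eq_iff image_iff) metis

text \<open>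
  The numbers whose signs decide whether a tuple is an allocation: its entries and the spare
  capacities of the servers.
\<close>

definition entries_and_slacks ::
    "('k::finite \<Rightarrow> 'n::finite set set) \<Rightarrow> ('k \<times> 'n set \<Rightarrow> real) \<Rightarrow> real set" where
  "entries_and_slacks \<R> l = l ` tuple_index \<R> \<union>
     range (\<lambda>\<nu>. 1 - (\<Sum>i\<in>UNIV. \<Sum>R\<in>{R \<in> \<R> i. \<nu> \<in> R}. l (i, R)))"

lemma finite_entries_and_slacks: "finite (entries_and_slacks \<R> l)"
  by (simp add: entries_and_slacks_def)

lemma entries_and_slacks_nonneg:
  "l \<in> allocation_polytope \<R> \<Longrightarrow> x \<in> entries_and_slacks \<R> l \<Longrightarrow> 0 \<le> x"
  by (auto simp: allocation_polytope_eq entries_and_slacks_def)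

text \<open>
  An additive map with \<open>\<phi> 1 = 1\<close> sends slacks to slacks and rates to rates, so nonnegativity of
  \<open>\<phi>\<close> on the entries and slacks is all that is needed.
\<close>

lemma additive_image_allocation:
  fixes \<R> :: "'k::finite \<Rightarrow> 'n::finite set set"
  assumes "Modules.additive \<phi>" and "\<phi> 1 = 1" and l: "l \<in> allocation_polytope \<R>"
    and nonneg: "\<And>x. x \<in> entries_and_slacks \<R> l \<Longrightarrow> 0 \<le> \<phi> x"
  shows "restrict (\<phi> \<circ> l) (tuple_index \<R>) \<in> allocation_polytope \<R>"
    and "rate_map \<R> (restrict (\<phi> \<circ> l) (tuple_index \<R>)) = (\<chi> i. \<phi> (rate_map \<R> l $ i))"
proof -
  interpret Modules.additive \<phi> by fact
  define l' where "l' = restrict (\<phi> \<circ> l) (tuple_index \<R>)"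
  have l': "l' (i, R) = \<phi> (l (i, R))" if "R \<in> \<R> i" for i R
    using that by (simp add: l'_def tuple_index_def)
  have slack: "1 - (\<Sum>i\<in>UNIV. \<Sum>R\<in>{R \<in> \<R> i. \<nu> \<in> R}. l' (i, R))
      = \<phi> (1 - (\<Sum>i\<in>UNIV. \<Sum>R\<in>{R \<in> \<R> i. \<nu> \<in> R}. l (i, R)))" for \<nu>
    by (simp add: diff sum l' \<open>\<phi> 1 = 1\<close>)
  show "restrict (\<phi> \<circ> l) (tuple_index \<R>) \<in> allocation_polytope \<R>"
    unfolding l'_def[symmetric] allocation_polytope_eq mem_Collect_eq slack
    using nonneg by (auto simp: entries_and_slacks_def real_tuples_def l'_def)
  show "rate_map \<R> (restrict (\<phi> \<circ> l) (tuple_index \<R>)) = (\<chi> i. \<phi> (rate_map \<R> l $ i))"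
    unfolding l'_def[symmetric] by (simp add: rate_map_def sum l')
qed

section \<open>Rationality of vertices and of allocations with rational rates\<close>

text \<open>
  The tuple \<open>l'\<close> is \<open>\<phi> \<circ> l\<close> for a map \<open>\<phi>\<close> close to the identity on the entries and slacks of \<open>l\<close>.
  Its reflected rate vector comes from the allocation \<open>\<psi> \<circ> l\<close> with \<open>\<psi> x = 2 * x - \<phi> x\<close>; the
  reflection excludes vertices with an irrational entry, and the last property gives the rational
  points of the region.
\<close>

lemma rational_allocation_with_reflected_rates:
  fixes \<R> :: "'k::finite \<Rightarrow> 'n::finite set set"
  assumes l: "l \<in> allocation_polytope \<R>"
  obtains l' where "l' \<in> allocation_polytope \<R> \<inter> rational_tuples \<R>"
    "2 *\<^sub>R rate_map \<R> l - rate_map \<R> l' \<in> service_rate_region \<R>"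
    "\<And>i. rate_map \<R> l $ i \<in> \<rat> \<Longrightarrow> rate_map \<R> l' $ i = rate_map \<R> l $ i"
proof -
  obtain \<phi> where add: "Modules.additive \<phi>" and rat: "\<And>x. \<phi> x \<in> \<rat>" and fixQ: "\<And>q. q \<in> \<rat> \<Longrightarrow> \<phi> q = q"
    and near: "\<And>x. x \<in> entries_and_slacks \<R> l \<Longrightarrow> \<bar>\<phi> x - x\<bar> \<le> \<bar>x\<bar>"
    using rational_additive_approximation[OF finite_entries_and_slacks[of \<R> l]] by metis
  define \<psi> where "\<psi> x = 2 * x - \<phi> x" for x
  have add': "Modules.additive \<psi>"
    by unfold_locales (simp add: \<psi>_def Modules.additive.add[OF add])
  have nonneg: "0 \<le> \<phi> x" "0 \<le> \<psi> x" if "x \<in> entries_and_slacks \<R> l" for x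
    using near[OF that] entries_and_slacks_nonneg[OF l that] by (auto simp: \<psi>_def)
  have one: "\<phi> 1 = 1" "\<psi> 1 = 1"
    using fixQ[of 1] by (auto simp: \<psi>_def)
  note \<phi> = additive_image_allocation[OF add one(1) l nonneg(1)]
  note \<psi> = additive_image_allocation[OF add' one(2) l nonneg(2)]
  show thesis
  proof
    show "restrict (\<phi> \<circ> l) (tuple_index \<R>) \<in> allocation_polytope \<R> \<inter> rational_tuples \<R>"
      using \<phi>(1) rat by (auto simp: rational_tuples_def)
    have "2 *\<^sub>R rate_map \<R> l - rate_map \<R> (restrict (\<phi> \<circ> l) (tuple_index \<R>))
        = rate_map \<R> (restrict (\<psi> \<circ> l) (tuple_index \<R>))"
      by (simp only: \<phi>(2) \<psi>(2)) (simp add: \<psi>_def vec_eq_iff)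
    then show "2 *\<^sub>R rate_map \<R> l - rate_map \<R> (restrict (\<phi> \<circ> l) (tuple_index \<R>))
        \<in> service_rate_region \<R>"
      using \<psi>(1) by (simp add: service_rate_region_eq_image)
    show "rate_map \<R> (restrict (\<phi> \<circ> l) (tuple_index \<R>)) $ i = rate_map \<R> l $ i"
      if "rate_map \<R> l $ i \<in> \<rat>" for i
      using fixQ[OF that] by (simp only: \<phi>(2)) simp
  qed
qed

lemma vertex_eq_if_reflection_in:
  assumes v: "vertex_of v P" and "u \<in> P" and "2 *\<^sub>R v - u \<in> P"
  shows "u = v"
proof (rule ccontr)
  assume "u \<noteq> v"
  then have "u \<in> P - {v}" "2 *\<^sub>R v - u \<in> P - {v}"
    using assms by (auto simp: algebra_simps scaleR_2)
  then have "(1/2) *\<^sub>R u + (1/2) *\<^sub>R (2 *\<^sub>R v - u) \<in> convex hull (P - {v})"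
    by (intro convexD[OF convex_convex_hull]) (auto intro: hull_inc)
  then have "v \<in> convex hull (P - {v})"
    by (simp add: algebra_simps)
  with v show False
    by (simp add: vertex_of_def)
qed

lemma rate_map_rational:
  assumes "l \<in> rational_tuples \<R>"
  shows "rate_map \<R> l $ i \<in> \<rat>"
  using assms
  by (auto simp: rate_map_def rational_tuples_def tuple_index_def PiE_iff intro!: Rats_sum)

theorem theorem2p6:
  fixes G :: "'a::{field,finite} ^ 'n::finite ^ 'k::finite"
    and \<R> :: "'k \<Rightarrow> 'n set set"
  assumes "CARD('k) \<ge> 2"
    and "CARD('n) > CARD('k)"
    and "rank G = CARD('k)"
    and "\<forall>\<nu>. column \<nu> G \<noteq> 0"
    and "G_system G \<R>"
  shows "(\<forall>v. vertex_of v (service_rate_region \<R>) \<longrightarrow> (\<forall>i. v $ i \<in> \<rat>)) \<and>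
    service_rate_region \<R> \<inter> rational_vectors
      = rate_map \<R> ` (allocation_polytope \<R> \<inter> rational_tuples \<R>)"
proof (intro conjI allI impI)
  fix v i
  assume v: "vertex_of v (service_rate_region \<R>)"
  then obtain l where l: "l \<in> allocation_polytope \<R>" and v_eq: "v = rate_map \<R> l"
    by (auto simp: vertex_of_def service_rate_region_eq_image)
  obtain l' where l': "l' \<in> allocation_polytope \<R> \<inter> rational_tuples \<R>"
    and refl: "2 *\<^sub>R v - rate_map \<R> l' \<in> service_rate_region \<R>"
    using rational_allocation_with_reflected_rates[OF l] v_eq by metis
  have "rate_map \<R> l' = v"
    using vertex_eq_if_reflection_in[OF v _ refl] l' by (auto simp: service_rate_region_eq_image)
  then show "v $ i \<in> \<rat>"
    using rate_map_rational l' by blast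
next
  show "service_rate_region \<R> \<inter> rational_vectors
      = rate_map \<R> ` (allocation_polytope \<R> \<inter> rational_tuples \<R>)"
  proof (intro equalityI subsetI)
    fix x
    assume "x \<in> service_rate_region \<R> \<inter> rational_vectors"
    then obtain l where l: "l \<in> allocation_polytope \<R>" and x_eq: "x = rate_map \<R> l"
      and x_rat: "\<And>i. x $ i \<in> \<rat>"
      by (auto simp: service_rate_region_eq_image rational_vectors_def)
    obtain l' where "l' \<in> allocation_polytope \<R> \<inter> rational_tuples \<R>"
      and "\<And>i. x $ i \<in> \<rat> \<Longrightarrow> rate_map \<R> l' $ i = x $ i"
      using rational_allocation_with_reflected_rates[OF l] x_eq by metis
    with x_rat show "x \<in> rate_map \<R> ` (allocation_polytope \<R> \<inter> rational_tuples \<R>)"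
      by (metis image_eqI vec_eq_iff)
  next
    fix x
    assume "x \<in> rate_map \<R> ` (allocation_polytope \<R> \<inter> rational_tuples \<R>)"
    then show "x \<in> service_rate_region \<R> \<inter> rational_vectors"
      using rate_map_rational by (auto simp: service_rate_region_eq_image rational_vectors_def)
  qed
qed

end
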